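(* Let $\mathfrak{A}$ be a unital $C^*$-algebra and let $x\in\mathfrak{A}$. Then the following hold. (i) $\sup\big\{\|\alpha\operatorname{Re}(x)+\beta\operatorname{Im}(x)\| : \alpha,\beta\in\mathbb{R},\ \alpha^2+\beta^2=1\big\} = v(x)$. (ii) $\max\big\{\|\operatorname{Re}(x)\|,\|\operatorname{Im}(x)\|\big\}\le v(x)$.
   Context: $\mathfrak{A}$ is a (nonzero, complex) $C^*$-algebra with unit $e$. For $x\in\mathfrak{A}$, $\operatorname{Re}(x)=\frac12(x+x^* )$ and $\operatorname{Im}(x)=\frac{1}{2i}(x-x^* )$. The set of normalized states is $\mathcal{S}(\mathfrak{A})=\{\varphi\in\mathfrak{A}':\varphi(e)=\|\varphi\|=1\}$, where $\mathfrak{A}'$ is the dual space of $\mathfrak{A}$. The numerical radius of $x$ is $v(x)=\sup\{|\varphi(x)|:\varphi\in\mathcal{S}(\mathfrak{A})\}$. *)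

theory Defs
  imports "HOL-Analysis.Analysis"
begin

(* A nonzero complex unital C*-algebra.  The library has only real scalar multiplication, so the
   complex one is a parameter that extends it.  The unit is 1; the laws 0 \<noteq> 1 and norm 1 = 1
   that come with real_normed_algebra_1 hold in every nonzero unital C*-algebra. *)
class unital_cstar_algebra = real_normed_algebra_1 + banach +
  fixes scaleC :: "complex \<Rightarrow> 'a \<Rightarrow> 'a"  (infixr \<open>*\<^sub>C\<close> 75)
    and star :: "'a \<Rightarrow> 'a"
  assumes scaleC_add_right: "c *\<^sub>C (x + y) = c *\<^sub>C x + c *\<^sub>C y"
    and scaleC_add_left: "(c + d) *\<^sub>C x = c *\<^sub>C x + d *\<^sub>C x"
    and scaleC_scaleC: "c *\<^sub>C d *\<^sub>C x = (c * d) *\<^sub>C x"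
    and scaleC_of_real: "complex_of_real r *\<^sub>C x = r *\<^sub>R x"
    and scaleC_mult_left: "(c *\<^sub>C x) * y = c *\<^sub>C (x * y)"
    and scaleC_mult_right: "x * (c *\<^sub>C y) = c *\<^sub>C (x * y)"
    and norm_scaleC: "norm (c *\<^sub>C x) = cmod c * norm x"
    and star_add: "star (x + y) = star x + star y"
    and star_scaleC: "star (c *\<^sub>C x) = cnj c *\<^sub>C star x"
    and star_mult: "star (x * y) = star y * star x"
    and star_star: "star (star x) = x"
    and cstar_identity: "norm (star x * x) = (norm x)\<^sup>2"

instantiation complex :: unital_cstar_algebra
begin

definition scaleC_complex :: "complex \<Rightarrow> complex \<Rightarrow> complex" where
  "scaleC_complex c z = c * z"

definition star_complex :: "complex \<Rightarrow> complex" where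
  "star_complex z = cnj z"

instance
  by standard
    (simp_all add: scaleC_complex_def star_complex_def algebra_simps norm_mult power2_eq_square
      scaleR_conv_of_real)

end

definition re_part :: "'a::unital_cstar_algebra \<Rightarrow> 'a" where
  "re_part x = (1/2) *\<^sub>C (x + star x)"

definition im_part :: "'a::unital_cstar_algebra \<Rightarrow> 'a" where
  "im_part x = (1 / (2 * \<i>)) *\<^sub>C (x - star x)"

definition dual_space :: "('a::unital_cstar_algebra \<Rightarrow> complex) set" where
  "dual_space = {\<phi>. bounded_linear \<phi> \<and> (\<forall>c x. \<phi> (c *\<^sub>C x) = c * \<phi> x)}"

definition states :: "('a::unital_cstar_algebra \<Rightarrow> complex) set" where
  "states = {\<phi> \<in> dual_space. \<phi> 1 = 1 \<and> onorm \<phi> = 1}"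

definition numerical_radius :: "'a::unital_cstar_algebra \<Rightarrow> real" where
  "numerical_radius x = (SUP \<phi>\<in>states. cmod (\<phi> x))"

end

theory Submission
  imports Defs
begin

text \<open>A state \<open>\<phi>\<close> is real on selfadjoint elements, so
  \<open>\<phi> (\<alpha> Re x + \<beta> Im x) = Re ((\<alpha> - \<i> \<beta>) \<phi> x)\<close>, whose maximum over the circle is \<open>\<bar>\<phi> x\<bar>\<close>;
  everything then follows once each selfadjoint \<open>a\<close> has a state with \<open>\<bar>\<phi> a\<bar> = \<parallel>a\<parallel>\<close>. Without spectral
  theory, such a state comes from a purely metric fact: for \<open>b = a\<close> or \<open>b = - a\<close> one has
  \<open>\<parallel>S + b\<parallel> = S + \<parallel>a\<parallel>\<close> for all \<open>S \<ge> 0\<close>. It makes \<open>j + k b \<mapsto> j + k \<parallel>a\<parallel>\<close> a contraction on the real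
  span of \<open>1\<close> and \<open>b\<close>, and a real Hahn-Banach extension \<open>f\<close> of it gives the state
  \<open>x \<mapsto> f x - \<i> f (\<i> x)\<close>.\<close>

section \<open>Real Hahn-Banach extension under a sublinear bound\<close>

text \<open>A functional on a subspace is represented below by its graph, a subspace of
  \<open>'a \<times> real\<close>; that \<open>G\<close> is single-valued follows from \<open>r \<le> p x\<close>.\<close>

lemma graph_subspace_unique:
  fixes p :: "'a::real_vector \<Rightarrow> real"
  assumes G: "subspace G" and dom: "\<And>x r. (x, r) \<in> G \<Longrightarrow> r \<le> p x" and p0: "p 0 = 0"
    and "(x, r) \<in> G" "(x, s) \<in> G"
  shows "r = s"
proof -
  have "(x, r) - (x, s) \<in> G" "(x, s) - (x, r) \<in> G"
    using assms subspace_diff by blast+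
  then have "r - s \<le> p 0" "s - r \<le> p 0"
    using dom by auto
  with p0 show ?thesis by simp
qed

text \<open>Admissible values \<open>c\<close> at \<open>x0\<close> are those lying above every
  \<open>r - p (x - x0)\<close> and below every \<open>p (y + x0) - s\<close>. Subadditivity puts
  each lower bound below each upper bound, so the supremum of the lower bounds serves.\<close>

lemma graph_subspace_extend:
  fixes p :: "'a::real_vector \<Rightarrow> real"
  assumes subadd: "\<And>x y. p (x + y) \<le> p x + p y"
    and hom: "\<And>c x. 0 \<le> c \<Longrightarrow> p (c *\<^sub>R x) = c * p x"
    and G: "subspace G" and dom: "\<And>x r. (x, r) \<in> G \<Longrightarrow> r \<le> p x"
  obtains c where "\<And>x r. (x, r) \<in> span (insert (x0, c) G) \<Longrightarrow> r \<le> p x"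
proof -
  define L where "L = (\<lambda>(x, r). r - p (x - x0)) ` G"
  have le: "r - p (x - x0) \<le> p (y + x0) - s" if "(x, r) \<in> G" "(y, s) \<in> G" for x r y s
  proof -
    have "(x, r) + (y, s) \<in> G"
      using G that subspace_add by blast
    then have "r + s \<le> p (x + y)"
      using dom by auto
    also have "\<dots> \<le> p (x - x0) + p (y + x0)"
      using subadd[of "x - x0" "y + x0"] by (simp add: algebra_simps)
    finally show ?thesis by simp
  qed
  have 0: "(0, 0) \<in> G"
    using subspace_0[OF G] by (simp add: zero_prod_def)
  have ne: "L \<noteq> {}" using 0 by (auto simp: L_def)
  have "bdd_above L"
    by (rule bdd_aboveI[of _ "p x0"]) (use le[OF _ 0] in \<open>auto simp: L_def\<close>)
  then have lower: "r - p (x - x0) \<le> Sup L" if "(x, r) \<in> G" for x r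
    using that by (intro cSup_upper) (force simp: L_def)+
  have upper: "Sup L \<le> p (y + x0) - s" if "(y, s) \<in> G" for y s
    using ne by (rule cSup_least) (use le that in \<open>auto simp: L_def\<close>)
  show ?thesis
  proof (rule that[of "Sup L"])
    fix x r assume "(x, r) \<in> span (insert (x0, Sup L) G)"
    then obtain k where k: "(x - k *\<^sub>R x0, r - k * Sup L) \<in> G"
      using G by (metis diff_Pair scaleR_Pair span_breakdown_eq span_eq_iff real_scaleR_def)
    \<comment> \<open>Dividing by the absolute value of \<open>k\<close> makes the coefficient of
      \<open>x0\<close> equal to 1 or -1; \<open>upper\<close> then settles the positive case and
      \<open>lower\<close> the negative one.\<close>
    consider "k = 0" | "k > 0" | "k < 0" by linarith
    then show "r \<le> p x"
    proof cases
      case 1 then show ?thesis using k dom by simp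
    next
      case 2
      from subspace_scale[OF G k, of "1/k"] 2
      have "((1/k) *\<^sub>R x - x0, r / k - Sup L) \<in> G"
        by (simp add: scaleR_diff_right diff_divide_distrib)
      from upper[OF this] have "r / k \<le> p ((1/k) *\<^sub>R x)" by simp
      then show ?thesis using 2 hom[of "1/k" x] by (simp add: divide_simps)
    next
      case 3
      from subspace_scale[OF G k, of "-1/k"] 3
      have "((-1/k) *\<^sub>R x + x0, - r / k + Sup L) \<in> G"
        by (simp add: scaleR_diff_right diff_divide_distrib)
      from lower[OF this] have "- r / k \<le> p ((-1/k) *\<^sub>R x)" by simp
      then show ?thesis using 3 hom[of "-1/k" x] by (simp add: divide_simps)
    qed
  qed
qed

text \<open>Zorn's lemma gives a maximal dominated graph above \<open>G\<close>. The one-dimensional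
  extension shows that its domain is everything, and domination makes it single-valued, hence the
  graph of a linear function.\<close>

lemma hahn_banach_graph:
  fixes p :: "'a::real_vector \<Rightarrow> real"
  assumes subadd: "\<And>x y. p (x + y) \<le> p x + p y"
    and hom: "\<And>c x. 0 \<le> c \<Longrightarrow> p (c *\<^sub>R x) = c * p x"
    and G: "subspace G" and dom: "\<And>x r. (x, r) \<in> G \<Longrightarrow> r \<le> p x"
  obtains f where "linear f" "\<And>x. f x \<le> p x" "\<And>x r. (x, r) \<in> G \<Longrightarrow> f x = r"
proof -
  define A where "A = {M. subspace M \<and> G \<subseteq> M \<and> (\<forall>(x, r)\<in>M. r \<le> p x)}"
  have "\<exists>M\<in>A. \<forall>X\<in>A. M \<subseteq> X \<longrightarrow> X = M"
  proof (rule subset_Zorn_nonempty)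
    show "A \<noteq> {}" using G dom by (auto simp: A_def)
    fix C assume C: "C \<noteq> {}" "subset.chain A C"
    have sub: "subspace X" "G \<subseteq> X" if "X \<in> C" for X
      using C that by (auto simp: subset.chain_def A_def)
    have "subspace (\<Union>C)"
    proof (rule subspaceI)
      show "0 \<in> \<Union>C" using C sub subspace_0 by blast
      show "x + y \<in> \<Union>C" if xy: "x \<in> \<Union>C" "y \<in> \<Union>C" for x y
      proof -
        obtain X Y where "X \<in> C" "Y \<in> C" "x \<in> X" "y \<in> Y" using xy by blast
        moreover have "X \<subseteq> Y \<or> Y \<subseteq> X"
          using C calculation unfolding subset.chain_def by blast
        ultimately show ?thesis
          using sub subspace_add by blast
      qed
      show "c *\<^sub>R x \<in> \<Union>C" if "x \<in> \<Union>C" for c x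
        using sub that subspace_scale by blast
    qed
    then show "\<Union>C \<in> A"
      using C sub by (fastforce simp: A_def subset.chain_def)
  qed
  then obtain M where "M \<in> A" and max: "\<And>X. X \<in> A \<Longrightarrow> M \<subseteq> X \<Longrightarrow> X = M"
    by blast
  then have M: "subspace M" "G \<subseteq> M" and domM: "\<And>x r. (x, r) \<in> M \<Longrightarrow> r \<le> p x"
    by (auto simp: A_def)
  have uniq: "r = s" if "(x, r) \<in> M" "(x, s) \<in> M" for x r s
    using graph_subspace_unique[of M p] M domM hom[of 0 0] that by simp
  have "\<exists>r. (x, r) \<in> M" for x
  proof -
    obtain c where c: "\<And>y r. (y, r) \<in> span (insert (x, c) M) \<Longrightarrow> r \<le> p y"
      using graph_subspace_extend[of p M x] subadd hom M domM by blast
    have "M \<subseteq> span (insert (x, c) M)"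
      using span_superset by blast
    then have "span (insert (x, c) M) = M"
      using c M by (intro max) (auto simp: A_def)
    then show ?thesis
      using span_base[of "(x, c)" "insert (x, c) M"] by auto
  qed
  then obtain f where f: "\<And>x. (x, f x) \<in> M" by metis
  show ?thesis
  proof (rule that)
    show "linear f"
    proof (rule linearI)
      fix x y :: 'a and c :: real
      show "f (x + y) = f x + f y"
        using uniq[OF f subspace_add[OF M(1) f[of x] f[of y], simplified]] .
      show "f (c *\<^sub>R x) = c *\<^sub>R f x"
        using uniq[OF f subspace_scale[OF M(1) f[of x], of c, simplified]] by simp
    qed
    show "f x \<le> p x" for x using domM f .
    show "f x = r" if "(x, r) \<in> G" for x r
      using uniq f M(2) that by blast
  qed
qed

section \<open>Elementary rules for complex scaling and the involution\<close>

lemma scaleC_minus_left: "(- c) *\<^sub>C x = - (c *\<^sub>C x)" for x :: "'a::unital_cstar_algebra"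
  by (metis scaleC_scaleC scaleC_of_real mult_minus1 of_real_1 of_real_minus scaleR_minus1_left)

lemma scaleC_diff_right: "c *\<^sub>C (x - y) = c *\<^sub>C x - c *\<^sub>C y"
  for x :: "'a::unital_cstar_algebra"
  by (metis add_diff_cancel_right' diff_add_cancel scaleC_add_right)

lemma star_scaleR [simp]: "star (r *\<^sub>R x) = r *\<^sub>R star x"
  for x :: "'a::unital_cstar_algebra"
  by (metis complex_cnj_complex_of_real scaleC_of_real star_scaleC)

lemma star_0 [simp]: "star (0::'a::unital_cstar_algebra) = 0"
  using star_scaleR[of 0 0] by simp

lemma star_minus [simp]: "star (- x) = - star x" for x :: "'a::unital_cstar_algebra"
  using star_scaleR[of "-1" x] by simp

lemma star_diff: "star (x - y) = star x - star y" for x :: "'a::unital_cstar_algebra"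
  using star_add[of x "- y"] by simp

lemma star_1 [simp]: "star (1::'a::unital_cstar_algebra) = 1"
  by (metis mult.left_neutral mult.right_neutral star_mult star_star)

text \<open>The C*-identity and submultiplicativity give one inequality; applying it to
  \<open>star x\<close> gives the other.\<close>

lemma norm_star [simp]: "norm (star x) = norm x" for x :: "'a::unital_cstar_algebra"
proof -
  have le: "norm y \<le> norm (star y)" for y :: 'a
  proof (cases "y = 0")
    case False
    have "norm y * norm y \<le> norm (star y) * norm y"
      by (metis cstar_identity norm_mult_ineq power2_eq_square)
    then show ?thesis using False by simp
  qed simp
  show ?thesis using le[of x] le[of "star x"] by (simp add: star_star)
qed

lemma bounded_linear_star: "bounded_linear (star :: 'a::unital_cstar_algebra \<Rightarrow> 'a)"
  by (rule bounded_linear_intro[where K = 1]) (simp_all add: star_add)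

lemmas continuous_on_star [continuous_intros] =
  bounded_linear.continuous_on[OF bounded_linear_star]

section \<open>Square roots near a positive multiple of the unit\<close>

text \<open>The root is \<open>1 - y\<close>, where \<open>y\<close> is the fixed point of the contraction
  \<open>y \<mapsto> (h + y\<^sup>2) / 2\<close>.\<close>

lemma sqrt_one_minus:
  fixes h :: "'a::unital_cstar_algebra"
  assumes h: "star h = h" "norm h < 1"
  shows "\<exists>y. star y = y \<and> y * y = 1 - h \<and> (\<forall>c. c * h = h * c \<longrightarrow> c * y = y * c)"
proof -
  define k where "k = norm h"
  define f where "f y = (1/2) *\<^sub>R (h + y * y)" for y :: 'a
  \<comment> \<open>The fixed point must be selfadjoint and commute with all that commutes with
    \<open>h\<close>. Both conditions are closed and preserved by \<open>f\<close>, so they are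
    built into the complete set. On the ball of radius \<open>k\<close> the map \<open>f\<close> has
    Lipschitz constant \<open>k\<close>.\<close>
  define S where "S = cball 0 k \<inter> {y. star y = y} \<inter> (\<Inter>c\<in>{c. c * h = h * c}. {y. c * y = y * c})"
  have k: "0 \<le> k" "k < 1" using h by (auto simp: k_def)
  have SD: "norm y \<le> k" "star y = y" "\<And>c. c * h = h * c \<Longrightarrow> c * y = y * c" if "y \<in> S" for y
    using that unfolding S_def by simp_all
  have "\<exists>!y. y \<in> S \<and> f y = y"
  proof (rule Banach_fix[where c = k])
    have "closed S"
      unfolding S_def
      by (intro closed_Int closed_INT closed_cball ballI closed_Collect_eq continuous_intros)
    then show "complete S" by (simp add: complete_eq_closed)
    have "0 \<in> S" using k by (simp add: S_def)
    then show "S \<noteq> {}" by blast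
    show "0 \<le> k" "k < 1" by (rule k)+
    show "f ` S \<subseteq> S"
    proof clarify
      fix y assume y: "y \<in> S"
      have "norm (y * y) \<le> k * k"
        using norm_mult_ineq[of y y] mult_mono[of "norm y" k "norm y" k] k SD(1)[OF y] by simp
      also have "\<dots> \<le> k" using k by (simp add: mult_left_le)
      finally have "norm (f y) \<le> k"
        using norm_triangle_ineq[of h "y * y"] by (simp add: f_def k_def)
      moreover have "star (f y) = f y"
        using SD(2)[OF y] h by (simp add: f_def star_add star_mult)
      moreover have "c * f y = f y * c" if "c * h = h * c" for c
      proof -
        have "c * y = y * c" using SD(3)[OF y that] .
        then have "c * (y * y) = y * y * c" by (metis mult.assoc)
        then show ?thesis using that by (simp add: f_def algebra_simps)
      qed
      ultimately show "f y \<in> S" by (simp add: S_def)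
    qed
    show "dist (f x) (f y) \<le> k * dist x y" if "x \<in> S" "y \<in> S" for x y
    proof -
      have n: "norm x \<le> k" "norm y \<le> k" using that SD(1) by auto
      \<comment> \<open>This splitting of \<open>x * x - y * y\<close> holds without
        commutativity.\<close>
      have "f x - f y = (1/2) *\<^sub>R ((x - y) * x + y * (x - y))"
        by (simp add: f_def algebra_simps)
      then have "norm (f x - f y) \<le> (norm ((x - y) * x) + norm (y * (x - y))) / 2"
        using norm_triangle_ineq[of "(x - y) * x" "y * (x - y)"] by simp
      also have "\<dots> \<le> (norm (x - y) * norm x + norm y * norm (x - y)) / 2"
        by (intro divide_right_mono add_mono norm_mult_ineq) simp
      also have "\<dots> \<le> (norm (x - y) * k + k * norm (x - y)) / 2"
        using n by (intro divide_right_mono add_mono mult_mono) (auto simp: k)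
      finally show ?thesis by (simp add: dist_norm mult.commute)
    qed
  qed
  then obtain y where y: "y \<in> S" "f y = y" by blast
  \<comment> \<open>The fixed-point equation \<open>y + y = h + y * y\<close> is
    \<open>(1 - y) * (1 - y) = 1 - h\<close> rearranged.\<close>
  have "2 *\<^sub>R f y = h + y * y" by (simp add: f_def)
  with y have eq: "y + y = h + y * y" by (simp add: scaleR_2)
  show ?thesis
  proof (intro exI[of _ "1 - y"] conjI allI impI)
    show "star (1 - y) = 1 - y" using SD(2)[OF y(1)] by (simp add: star_diff)
    have "(1 - y) * (1 - y) = 1 - (y + y) + y * y" by (simp add: algebra_simps)
    then show "(1 - y) * (1 - y) = 1 - h" by (simp add: eq)
    fix c assume "c * h = h * c"
    then have "c * y = y * c" by (rule SD(3)[OF y(1)])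
    then show "c * (1 - y) = (1 - y) * c" by (simp add: algebra_simps)
  qed
qed

lemma sqrt_scalar_minus:
  fixes h :: "'a::unital_cstar_algebra"
  assumes h: "star h = h" "norm h < s"
  shows "\<exists>y. star y = y \<and> y * y = s *\<^sub>R 1 - h \<and> (\<forall>c. c * h = h * c \<longrightarrow> c * y = y * c)"
proof -
  have s: "s > 0" using h norm_ge_zero[of h] by linarith
  have "star ((1/s) *\<^sub>R h) = (1/s) *\<^sub>R h" "norm ((1/s) *\<^sub>R h) < 1"
    using h s by auto
  from sqrt_one_minus[OF this] obtain y where y: "star y = y" "y * y = 1 - (1/s) *\<^sub>R h"
    "\<forall>c. c * ((1/s) *\<^sub>R h) = ((1/s) *\<^sub>R h) * c \<longrightarrow> c * y = y * c"
    by blast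
  show ?thesis
  proof (intro exI[of _ "sqrt s *\<^sub>R y"] conjI allI impI)
    show "star (sqrt s *\<^sub>R y) = sqrt s *\<^sub>R y" by (simp add: y)
    show "sqrt s *\<^sub>R y * sqrt s *\<^sub>R y = s *\<^sub>R 1 - h"
      using s by (simp add: y scaleR_diff_right)
    fix c assume "c * h = h * c"
    then show "c * sqrt s *\<^sub>R y = sqrt s *\<^sub>R y * c" using y(3) by simp
  qed
qed

section \<open>Norms of selfadjoint elements shifted by scalars\<close>

text \<open>Both \<open>r - e\<close> and \<open>r + e\<close> have square roots; if \<open>w\<close> is their product, then
  \<open>e + \<i> w\<close> is \<open>r\<close> times a unitary with real part \<open>e\<close>.\<close>

lemma norm_le_of_shifts:
  fixes e :: "'a::unital_cstar_algebra"
  assumes e: "star e = e"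
    and plus: "norm (S *\<^sub>R 1 + e) < S + r" and minus: "norm (S *\<^sub>R 1 - e) < S + r"
  shows "norm e \<le> \<bar>r\<bar>"
proof -
  have "star (S *\<^sub>R 1 + e) = S *\<^sub>R 1 + e" "star (S *\<^sub>R 1 - e) = S *\<^sub>R 1 - e"
    by (simp_all add: star_add star_diff e)
  note sqrt_scalar_minus[OF this(1) plus] sqrt_scalar_minus[OF this(2) minus]
  then obtain y z where y: "star y = y" "y * y = (S + r) *\<^sub>R 1 - (S *\<^sub>R 1 + e)"
      "\<And>c. c * (S *\<^sub>R 1 + e) = (S *\<^sub>R 1 + e) * c \<Longrightarrow> c * y = y * c"
    and z: "star z = z" "z * z = (S + r) *\<^sub>R 1 - (S *\<^sub>R 1 - e)"
      "\<And>c. c * (S *\<^sub>R 1 - e) = (S *\<^sub>R 1 - e) * c \<Longrightarrow> c * z = z * c"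
    by blast
  \<comment> \<open>The commutation clauses of the roots are used in turn: \<open>e\<close> commutes
    with both shifts, hence with \<open>y\<close> and \<open>z\<close>; then \<open>z\<close>
    commutes with \<open>S *\<^sub>R 1 + e\<close>, hence with \<open>y\<close>.\<close>
  have ey: "e * y = y * e" by (rule y) (simp add: algebra_simps)
  have ez: "e * z = z * e" by (rule z) (simp add: algebra_simps)
  have zy: "z * y = y * z" by (rule y) (simp add: algebra_simps ez)
  define w where "w = y * z"
  have ww: "w * w = r\<^sup>2 *\<^sub>R 1 - e * e"
  proof -
    have "w * w = (y * y) * (z * z)" unfolding w_def by (metis mult.assoc zy)
    also have "\<dots> = (r *\<^sub>R 1 - e) * (r *\<^sub>R 1 + e)"
      unfolding y(2) z(2) by (simp add: scaleR_add_left)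
    finally show ?thesis by (simp add: algebra_simps power2_eq_square)
  qed
  have ew: "e * w = w * e" unfolding w_def by (metis ey ez mult.assoc)
  have w: "star w = w" by (simp add: w_def star_mult y(1) z(1) zy)
  define u where "u = e + \<i> *\<^sub>C w"
  have su: "star u = e - \<i> *\<^sub>C w" by (simp add: u_def star_add star_scaleC e w scaleC_minus_left)
  have "\<i> *\<^sub>C \<i> *\<^sub>C v = - v" for v :: 'a
    using scaleC_of_real[of "-1" v] by (simp add: scaleC_scaleC)
  then have "star u * u = e * e + w * w"
    unfolding su by (simp add: u_def algebra_simps scaleC_mult_left scaleC_mult_right scaleC_diff_right ew)
  then have "star u * u = r\<^sup>2 *\<^sub>R 1" by (simp add: ww)
  then have "(norm u)\<^sup>2 = r\<^sup>2" using cstar_identity[of u] by simp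
  then have "norm u = \<bar>r\<bar>" by (metis real_sqrt_abs abs_norm_cancel)
  moreover have "e = (1/2) *\<^sub>R (u + star u)"
    unfolding su by (simp add: u_def flip: scaleR_2)
  then have "norm e \<le> (norm u + norm (star u)) / 2"
    using norm_triangle_ineq[of u "star u"] by simp
  ultimately show ?thesis by simp
qed

text \<open>If equality failed for both signs, it would fail for both at one common shift
  \<open>R\<close>, leaving room for some \<open>r < norm a\<close> with both shifted norms below
  \<open>R + r\<close>. Then \<open>norm_le_of_shifts\<close> would give
  \<open>norm a \<le> r\<close>.\<close>

lemma norm_shift_add:
  fixes a :: "'a::unital_cstar_algebra"
  assumes a: "star a = a"
  shows "\<exists>b\<in>{a, - a}. \<forall>S\<ge>0. norm (S *\<^sub>R 1 + b) = S + norm a"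
proof -
  \<comment> \<open>A strict deficit survives any larger shift, so the two failures can be moved to
    \<open>max S T\<close>.\<close>
  have mono: "norm (T *\<^sub>R 1 + b) < T + norm b" if "norm (S *\<^sub>R 1 + b) < S + norm b" "S \<le> T"
    for S T and b :: 'a
  proof -
    have "norm (T *\<^sub>R 1 + b) \<le> norm ((T - S) *\<^sub>R (1::'a)) + norm (S *\<^sub>R 1 + b)"
      using norm_triangle_ineq[of "(T - S) *\<^sub>R 1" "S *\<^sub>R 1 + b"] by (simp add: algebra_simps)
    with that show ?thesis by simp
  qed
  have le: "norm (S *\<^sub>R 1 + b) \<le> S + norm b" if "0 \<le> S" for S and b :: 'a
    using norm_triangle_ineq[of "S *\<^sub>R 1" b] that by simp
  have "(\<forall>S\<ge>0. norm (S *\<^sub>R 1 + a) = S + norm a) \<or> (\<forall>S\<ge>0. norm (S *\<^sub>R 1 + - a) = S + norm a)"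
  proof (rule ccontr)
    assume "\<not> ?thesis"
    then obtain S T where S: "norm (S *\<^sub>R 1 + a) < S + norm a" and "0 \<le> S"
      and T: "norm (T *\<^sub>R 1 + - a) < T + norm (- a)"
      using le[of _ a] le[of _ "- a"] by (force simp: less_le)
    define R where "R = max S T"
    have "0 \<le> R" using \<open>0 \<le> S\<close> by (simp add: R_def)
    have "norm (R *\<^sub>R 1 + a) < R + norm a" "norm (R *\<^sub>R 1 + - a) < R + norm a"
      using mono[OF S] mono[OF T] by (auto simp: R_def)
    then have "max (norm (R *\<^sub>R 1 + a)) (norm (R *\<^sub>R 1 - a)) - R < norm a"
      by simp
    then obtain r where "max (norm (R *\<^sub>R 1 + a)) (norm (R *\<^sub>R 1 - a)) - R < r"
      and r_less: "r < norm a"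
      using dense by blast
    then have r: "norm (R *\<^sub>R 1 + a) < R + r" "norm (R *\<^sub>R 1 - a) < R + r"
      by linarith+
    \<comment> \<open>The bound from \<open>norm_le_of_shifts\<close> is the absolute value of
      \<open>r\<close>, so \<open>r\<close> has to be shown nonnegative.\<close>
    have "2 * R \<le> norm (R *\<^sub>R 1 + a) + norm (R *\<^sub>R 1 - a)"
      using norm_triangle_ineq[of "R *\<^sub>R 1 + a" "R *\<^sub>R 1 - a"] \<open>0 \<le> R\<close>
      by (simp flip: scaleR_2)
    then have "0 \<le> r" using r by linarith
    with norm_le_of_shifts[OF a r] r_less show False by simp
  qed
  then show ?thesis by blast
qed

section \<open>Existence of norming states\<close>

lemma norming_state:
  fixes a :: "'a::unital_cstar_algebra"
  assumes a: "star a = a"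
  obtains \<phi> where "\<phi> \<in> states" "norm a \<le> cmod (\<phi> a)"
proof -
  obtain b where b: "b = a \<or> b = - a"
    and shift: "\<And>S. 0 \<le> S \<Longrightarrow> norm (S *\<^sub>R 1 + b) = S + norm a"
    using norm_shift_add[OF a] by blast
  have nb: "norm b = norm a" using b by auto
  have shift_le: "s + norm b \<le> norm (s *\<^sub>R 1 + b)" for s
  proof (cases "0 \<le> s")
    case False
    then show ?thesis
      using norm_triangle_ineq[of "s *\<^sub>R 1 + b" "(- s) *\<^sub>R 1"] by simp
  qed (simp add: shift nb)
  \<comment> \<open>The elements 1 and \<open>b\<close> may be linearly dependent;
    \<open>dom\<close> still makes this graph single-valued.\<close>
  define G where "G = span {(1::'a, 1::real), (b, norm b)}"
  have G_eq: "(x, r) \<in> G \<longleftrightarrow> (\<exists>j k. x = j *\<^sub>R 1 + k *\<^sub>R b \<and> r = j + k * norm b)" for x r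
    unfolding G_def by (auto simp: span_breakdown_eq zero_prod_def algebra_simps)
  have dom: "r \<le> norm x" if "(x, r) \<in> G" for x r
  proof -
    obtain j k where x: "x = j *\<^sub>R 1 + k *\<^sub>R b" and r: "r = j + k * norm b"
      using \<open>(x, r) \<in> G\<close> G_eq by blast
    show ?thesis
    proof (cases "0 < k")
      case True
      then have "r = k * (j / k + norm b)" by (simp add: r field_simps)
      also have "\<dots> \<le> k * norm ((j / k) *\<^sub>R 1 + b)"
        using shift_le True by (intro mult_left_mono) auto
      also have "\<dots> = norm (k *\<^sub>R ((j / k) *\<^sub>R 1 + b))" using True by simp
      also have "k *\<^sub>R ((j / k) *\<^sub>R 1 + b) = x" using True by (simp add: x algebra_simps)
      finally show ?thesis .
    next
      \<comment> \<open>Here \<open>x - k *\<^sub>R b\<close> is \<open>j\<close> times the unit, so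
        \<open>j\<close> is at most \<open>norm x - k * norm b\<close>.\<close>
      case False
      then show ?thesis
        using norm_triangle_ineq[of x "(- k) *\<^sub>R b"] by (simp add: x r)
    qed
  qed
  obtain f where lin: "linear f" and le: "\<And>x. f x \<le> norm x"
    and ext: "\<And>x r. (x, r) \<in> G \<Longrightarrow> f x = r"
    by (rule hahn_banach_graph[of norm G])
      (use dom norm_triangle_ineq in \<open>auto simp: G_def\<close>)
  have f1: "f 1 = 1" and fb: "f b = norm b"
    by (auto intro!: ext simp: G_def span_base)
  \<comment> \<open>The standard complexification: the complex-linear functional with real part
    \<open>f\<close>.\<close>
  define \<phi> where "\<phi> x = Complex (f x) (- f (\<i> *\<^sub>C x))" for x
  have f_add: "f (x + y) = f x + f y" and f_scale: "f (c *\<^sub>R x) = c * f x" for x y c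
    using lin by (auto simp: linear_add linear_scale)
  have \<phi>_add: "\<phi> (x + y) = \<phi> x + \<phi> y" for x y
    by (simp add: \<phi>_def complex_eq_iff f_add scaleC_add_right)
  have f_C: "f (c *\<^sub>C x) = Re c * f x + Im c * f (\<i> *\<^sub>C x)" for c x
  proof -
    have "c = complex_of_real (Re c) + complex_of_real (Im c) * \<i>"
      by (simp add: complex_eq_iff)
    then have "c *\<^sub>C x = Re c *\<^sub>R x + Im c *\<^sub>R (\<i> *\<^sub>C x)"
      by (metis scaleC_add_left scaleC_of_real scaleC_scaleC)
    then show ?thesis by (simp add: f_add f_scale)
  qed
  have \<phi>_C: "\<phi> (c *\<^sub>C x) = c * \<phi> x" for c x
    using f_C[of c x] f_C[of "\<i> * c" x] by (simp add: \<phi>_def complex_eq_iff scaleC_scaleC)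
  have bound: "cmod (\<phi> x) \<le> norm x" for x
  proof -
    \<comment> \<open>Rotating by a phase makes the value real and nonnegative, so the bound on the
      real part \<open>f\<close> suffices.\<close>
    obtain c where c: "cmod c = 1" "c * \<phi> x = cmod (\<phi> x)"
    proof (cases "\<phi> x = 0")
      case True then show ?thesis using that[of 1] by simp
    next
      case False
      have "cnj (\<phi> x) * \<phi> x = complex_of_real (cmod (\<phi> x)) * complex_of_real (cmod (\<phi> x))"
        using complex_norm_square[of "\<phi> x"] by (simp add: power2_eq_square mult.commute)
      then show ?thesis
        using that[of "cnj (\<phi> x) / cmod (\<phi> x)"] False by (simp add: norm_divide)
    qed
    have "cmod (\<phi> x) = Re (\<phi> (c *\<^sub>C x))" by (simp add: \<phi>_C c)
    also have "\<dots> \<le> norm (c *\<^sub>C x)" using le by (simp add: \<phi>_def)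
    finally show ?thesis by (simp add: norm_scaleC c)
  qed
  \<comment> \<open>The real part of \<open>\<phi> 1\<close> is already 1, so modulus at most 1
    forces the imaginary part to vanish.\<close>
  have "(cmod (\<phi> 1))\<^sup>2 \<le> 1" using bound[of 1] by (simp add: power_le_one)
  then have "\<phi> 1 = 1" by (simp add: \<phi>_def f1 cmod_power2 complex_eq_iff)
  have bl: "bounded_linear \<phi>"
  proof (rule bounded_linear_intro)
    show "norm (\<phi> x) \<le> norm x * 1" for x using bound by simp
    show "\<phi> (r *\<^sub>R x) = r *\<^sub>R \<phi> x" for r x
      by (metis \<phi>_C scaleC_of_real scaleR_conv_of_real)
  qed (rule \<phi>_add)
  have "onorm \<phi> = 1"
  proof (rule antisym)
    show "onorm \<phi> \<le> 1" by (rule onorm_le) (simp add: bound)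
    show "1 \<le> onorm \<phi>" using onorm[OF bl, of 1] \<open>\<phi> 1 = 1\<close> by simp
  qed
  with bl \<phi>_C \<open>\<phi> 1 = 1\<close> have "\<phi> \<in> states"
    by (simp add: states_def dual_space_def)
  moreover have "norm a \<le> cmod (\<phi> b)"
    using complex_Re_le_cmod[of "\<phi> b"] by (simp add: \<phi>_def fb nb)
  moreover have "cmod (\<phi> b) = cmod (\<phi> a)"
    using b linear_neg[OF bounded_linear.linear[OF bl], of a] by auto
  ultimately show ?thesis using that by simp
qed

section \<open>States are contractive, and real on selfadjoint elements\<close>

lemma state_bound: "\<phi> \<in> states \<Longrightarrow> cmod (\<phi> x) \<le> norm x"
  using onorm[of \<phi> x] by (auto simp: states_def dual_space_def)

text \<open>If \<open>\<phi> a = s + \<i> t\<close>, then \<open>s\<^sup>2 + (t + l)\<^sup>2 \<le> \<parallel>a + \<i> l\<parallel>\<^sup>2 \<le> \<parallel>a\<parallel>\<^sup>2 + l\<^sup>2\<close> for every real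
  \<open>l\<close>, which forces \<open>t = 0\<close>.\<close>

lemma state_selfadjoint_real:
  fixes a :: "'a::unital_cstar_algebra"
  assumes \<phi>: "\<phi> \<in> states" and a: "star a = a"
  shows "Im (\<phi> a) = 0"
proof (rule ccontr)
  assume t: "Im (\<phi> a) \<noteq> 0"
  define t where "t = Im (\<phi> a)"
  have key: "2 * t * l \<le> (norm a)\<^sup>2" for l :: real
  proof -
    define u where "u = a + (\<i> * l) *\<^sub>C 1"
    have su: "star u = a - (\<i> * l) *\<^sub>C 1"
      by (simp add: u_def star_add star_scaleC a scaleC_minus_left)
    have sq: "(\<i> * l) * (\<i> * l) = complex_of_real (- l\<^sup>2)"
      by (simp add: complex_eq_iff power2_eq_square)
    have "(\<i> * l) *\<^sub>C (\<i> * l) *\<^sub>C (1::'a) = - (l\<^sup>2 *\<^sub>R 1)"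
      unfolding scaleC_scaleC sq scaleC_of_real by simp
    then have "star u * u = a * a + l\<^sup>2 *\<^sub>R 1"
      unfolding su by (simp add: u_def algebra_simps scaleC_mult_left scaleC_mult_right scaleC_diff_right)
    then have "(norm u)\<^sup>2 = norm (a * a + l\<^sup>2 *\<^sub>R 1)"
      using cstar_identity[of u] by simp
    also have "\<dots> \<le> norm (a * a) + l\<^sup>2"
      using norm_triangle_ineq[of "a * a" "l\<^sup>2 *\<^sub>R 1"] by simp
    also have "norm (a * a) = (norm a)\<^sup>2"
      using cstar_identity[of a] a by simp
    finally have "(norm u)\<^sup>2 \<le> (norm a)\<^sup>2 + l\<^sup>2" .
    moreover have "(cmod (\<phi> u))\<^sup>2 \<le> (norm u)\<^sup>2"
      using state_bound[OF \<phi>] by (simp add: power_mono)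
    moreover have "\<phi> u = \<phi> a + \<i> * l"
      using \<phi> by (auto simp: u_def states_def dual_space_def linear_add bounded_linear.linear)
    then have "(cmod (\<phi> u))\<^sup>2 = (Re (\<phi> a))\<^sup>2 + (t + l)\<^sup>2"
      by (simp add: cmod_power2 t_def)
    ultimately show ?thesis
      unfolding power2_sum using zero_le_power2[of "Re (\<phi> a)"] zero_le_power2[of t] by linarith
  qed
  \<comment> \<open>The value of \<open>l\<close> is chosen so that \<open>2 * t * l\<close> exceeds
    the bound in \<open>key\<close> by exactly 1.\<close>
  have "(norm a)\<^sup>2 + 1 \<le> (norm a)\<^sup>2"
    using key[of "((norm a)\<^sup>2 + 1) / (2 * t)"] t by (simp add: t_def)
  then show False by simp
qed

section \<open>States on real and imaginary parts\<close>

lemma star_re_part: "star (re_part x) = re_part x"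
  by (simp add: re_part_def star_scaleC star_add star_star add.commute)

lemma star_im_part: "star (im_part x) = im_part x"
proof -
  have "star (im_part x) = (- (1 / (2 * \<i>))) *\<^sub>C (star x - x)"
    by (simp add: im_part_def star_scaleC star_diff star_star)
  also have "star x - x = complex_of_real (-1) *\<^sub>C (x - star x)"
    unfolding scaleC_of_real by simp
  finally show ?thesis by (simp add: scaleC_scaleC im_part_def)
qed

lemma re_part_im_part: "x = re_part x + \<i> *\<^sub>C im_part x"
proof -
  have "\<i> *\<^sub>C im_part x = complex_of_real (1/2) *\<^sub>C (x - star x)"
    by (simp add: im_part_def scaleC_scaleC)
  moreover have "re_part x = complex_of_real (1/2) *\<^sub>C (x + star x)"
    by (simp add: re_part_def)
  ultimately show ?thesis
    unfolding scaleC_of_real by (simp flip: scaleR_add_right add: scaleR_2[symmetric])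
qed

text \<open>Since \<open>\<phi>\<close> is real on both parts, its values there are the real and
  imaginary parts of \<open>\<phi> x\<close>. This reduces the supremum over the circle to plane
  geometry.\<close>

lemma state_rotated_part:
  assumes \<phi>: "\<phi> \<in> states"
  shows "\<phi> (\<alpha> *\<^sub>R re_part x + \<beta> *\<^sub>R im_part x) = complex_of_real (\<alpha> * Re (\<phi> x) + \<beta> * Im (\<phi> x))"
proof -
  have lin: "linear \<phi>" and C: "\<And>c x. \<phi> (c *\<^sub>C x) = c * \<phi> x"
    using \<phi> by (auto simp: states_def dual_space_def bounded_linear.linear)
  have "\<phi> x = \<phi> (re_part x) + \<i> * \<phi> (im_part x)"
    by (metis C lin linear_add re_part_im_part)
  moreover have "Im (\<phi> (re_part x)) = 0" "Im (\<phi> (im_part x)) = 0"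
    using state_selfadjoint_real \<phi> star_re_part star_im_part by blast+
  ultimately show ?thesis
    by (simp add: linear_add[OF lin] linear_scale[OF lin] complex_eq_iff)
qed

theorem theorem2p6:
  fixes x :: "'a::unital_cstar_algebra"
  shows "(SUP (\<alpha>, \<beta>)\<in>{(\<alpha>::real, \<beta>::real). \<alpha>\<^sup>2 + \<beta>\<^sup>2 = 1}.
            norm (\<alpha> *\<^sub>R re_part x + \<beta> *\<^sub>R im_part x)) = numerical_radius x
       \<and> max (norm (re_part x)) (norm (im_part x)) \<le> numerical_radius x"
proof -
  define C where "C = {(\<alpha>::real, \<beta>::real). \<alpha>\<^sup>2 + \<beta>\<^sup>2 = 1}"
  define N where "N \<alpha> \<beta> = norm (\<alpha> *\<^sub>R re_part x + \<beta> *\<^sub>R im_part x)" for \<alpha> \<beta>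
  have "bdd_above ((\<lambda>\<phi>. cmod (\<phi> x)) ` states)"
    using state_bound by (auto intro!: bdd_aboveI2)
  then have v: "cmod (\<phi> x) \<le> numerical_radius x" if "\<phi> \<in> states" for \<phi>
    unfolding numerical_radius_def using that by (intro cSUP_upper)
  have N_le: "N \<alpha> \<beta> \<le> numerical_radius x" if "(\<alpha>, \<beta>) \<in> C" for \<alpha> \<beta>
  proof -
    have "star (\<alpha> *\<^sub>R re_part x + \<beta> *\<^sub>R im_part x) = \<alpha> *\<^sub>R re_part x + \<beta> *\<^sub>R im_part x"
      by (simp add: star_add star_re_part star_im_part)
    then obtain \<phi> where \<phi>: "\<phi> \<in> states" "N \<alpha> \<beta> \<le> cmod (\<phi> (\<alpha> *\<^sub>R re_part x + \<beta> *\<^sub>R im_part x))"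
      unfolding N_def by (rule norming_state)
    note \<phi>(2)
    also have "\<dots> = \<bar>Re (Complex \<alpha> (- \<beta>) * \<phi> x)\<bar>"
      unfolding state_rotated_part[OF \<phi>(1)] norm_of_real by simp
    also have "\<dots> \<le> cmod (Complex \<alpha> (- \<beta>)) * cmod (\<phi> x)"
      by (metis abs_Re_le_cmod norm_mult)
    also have "cmod (Complex \<alpha> (- \<beta>)) = 1"
      using that by (simp add: C_def complex_norm)
    finally show ?thesis using v[OF \<phi>(1)] by simp
  qed
  have C0: "(1, 0) \<in> C" "(0, 1) \<in> C" by (auto simp: C_def)
  have le_N: "cmod (\<phi> x) \<le> (SUP (\<alpha>, \<beta>)\<in>C. N \<alpha> \<beta>)" if \<phi>: "\<phi> \<in> states" for \<phi>
  proof -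
    \<comment> \<open>The maximum is attained at the unit vector in the direction of
      \<open>\<phi> x\<close>; if \<open>\<phi> x = 0\<close>, any point of the circle will
      do.\<close>
    obtain \<alpha> \<beta> where \<alpha>\<beta>: "(\<alpha>, \<beta>) \<in> C" "\<alpha> * Re (\<phi> x) + \<beta> * Im (\<phi> x) = cmod (\<phi> x)"
    proof (cases "\<phi> x = 0")
      case True then show ?thesis using that C0 by auto
    next
      case False
      then have "Re (\<phi> x) / cmod (\<phi> x) * Re (\<phi> x) + Im (\<phi> x) / cmod (\<phi> x) * Im (\<phi> x) = cmod (\<phi> x)"
        using cmod_power2[of "\<phi> x"] by (simp add: field_simps power2_eq_square)
      moreover have "(Re (\<phi> x) / cmod (\<phi> x), Im (\<phi> x) / cmod (\<phi> x)) \<in> C"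
        using False by (simp add: C_def power_divide cmod_power2[symmetric] flip: add_divide_distrib)
      ultimately show ?thesis using that by blast
    qed
    have "cmod (\<phi> x) = cmod (\<phi> (\<alpha> *\<^sub>R re_part x + \<beta> *\<^sub>R im_part x))"
      unfolding state_rotated_part[OF \<phi>] \<alpha>\<beta>(2) by simp
    also have "\<dots> \<le> N \<alpha> \<beta>"
      unfolding N_def by (rule state_bound[OF \<phi>])
    also have "\<dots> \<le> (SUP (\<alpha>, \<beta>)\<in>C. N \<alpha> \<beta>)"
      using \<alpha>\<beta>(1) N_le
      by (intro cSUP_upper2[where x = "(\<alpha>, \<beta>)"]) (auto intro!: bdd_aboveI2)
    finally show ?thesis .
  qed
  \<comment> \<open>A state norming the unit shows that the supremum defining
    \<open>numerical_radius\<close> is over a nonempty set.\<close>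
  have "states \<noteq> ({} :: ('a \<Rightarrow> complex) set)"
    using norming_state[OF star_1] by blast
  then have "numerical_radius x \<le> (SUP (\<alpha>, \<beta>)\<in>C. N \<alpha> \<beta>)"
    unfolding numerical_radius_def using le_N by (rule cSUP_least)
  moreover have "(SUP (\<alpha>, \<beta>)\<in>C. N \<alpha> \<beta>) \<le> numerical_radius x"
    using C0 N_le by (intro cSUP_least) auto
  \<comment> \<open>The second claim is the bound \<open>N_le\<close> at the points (1, 0) and (0,
    1) of the circle.\<close>
  moreover have "norm (re_part x) \<le> numerical_radius x" "norm (im_part x) \<le> numerical_radius x"
    using N_le[OF C0(1)] N_le[OF C0(2)] by (auto simp: N_def)
  ultimately show ?thesis unfolding C_def N_def by simp
qed

end
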